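(* Let $X$ and $Y$ be proper metric spaces. Every continuous quasi-isometric embedding $f:X\to Y$ extends to a continuous map $\tilde f:X_{QG}\to Y_{QG}$ of the quasi-geodesic compactifications that restricts to a map of quasi-geodesic boundaries $\partial_{QG}X\to\partial_{QG}Y$.
   Context: $Z_+$ is the set of positive integers. For $q\ge 1$, $Q\ge 0$, an integral $(q,Q)$-quasi-geodesic in a metric space $(X,d)$ is a function $g:(a,b)\cap Z_+\to X$ (the interval may be unbounded) with $\frac{|x-y|}{q}-Q\le d(g(x),g(y))\le q|x-y|+Q$ for all $x,y$ in its domain. It originates at $x_0$ if $1$ is in its domain and $g(1)=x_0$; it is a ray if its domain is $Z_+$. For $k\ge 1$, $m\ge 1$ and an integral $(k,k)$-quasi-geodesic ray $g$ with $g(1)=x_0$, the $m$-cone $C_X(x_0,k,k,g,m)$ is the set of all $x\in X$ such that $x=h(i)$ for some $i\ge m$ and some integral $(k,k)$-quasi-geodesic $h$ (possibly with finite domain) with $h(1)=x_0$ and $h(j)=g(j)$ for all $j\le m$. A function $f:X\to\mathbb{C}$ is slowly-oscillating if $|f(x_n)-f(y_n)|\to 0$ whenever $x_n\to\infty$ (i.e. $d(x_0,x_n)\to\infty$) and $d(x_n,y_n)<M$ for all $n$, for some $M>0$. A bounded continuous slowly-oscillating function $f:X\to\mathbb{C}$ is geometrically slowly-oscillating if for every $\epsilon>0$, every $k\ge1$, every $x_0\in X$ and every integral $(k,k)$-quasi-geodesic ray $g$ in $X$ originating at $x_0$ there is $m\ge 1$ such that the diameter of $f(C_X(x_0,k,k,g,m))$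 is smaller than $\epsilon$. $C_{QG}(X)$ is the $C^*$-algebra of all geometrically slowly-oscillating functions on $X$. The quasi-geodesic compactification $X_{QG}$ is the maximal ideal space of $C_{QG}(X)$ (equivalently, the compactification of $X$ such that the functions in $C_{QG}(X)$ are exactly the restrictions to $X$ of continuous functions $X_{QG}\to\mathbb{C}$). For proper $X$, the quasi-geodesic boundary is $\partial_{QG}X:=X_{QG}\setminus X$. *)

theory Defs
  imports "HOL-Analysis.Analysis"
begin

text \<open>A quasi-geodesic is a total function together with its domain
  \<open>D = (a,b) \<inter> Z\<^sub>+\<close>; its values outside \<open>D\<close> are irrelevant.
  The interval is an interval of extended reals, so it may be unbounded.\<close>

definition integral_interval :: "nat set \<Rightarrow> bool" where
  "integral_interval D \<longleftrightarrow>
     (\<exists>a b :: ereal. D = {n. 1 \<le> n \<and> a < ereal (real n) \<and> ereal (real n) < b})"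

definition integral_quasi_geodesic ::
    "real \<Rightarrow> real \<Rightarrow> nat set \<Rightarrow> (nat \<Rightarrow> 'a::metric_space) \<Rightarrow> bool" where
  "integral_quasi_geodesic q Q D g \<longleftrightarrow>
     integral_interval D \<and>
     (\<forall>x\<in>D. \<forall>y\<in>D.
        \<bar>real x - real y\<bar> / q - Q \<le> dist (g x) (g y) \<and>
        dist (g x) (g y) \<le> q * \<bar>real x - real y\<bar> + Q)"

definition originates_at :: "nat set \<Rightarrow> (nat \<Rightarrow> 'a) \<Rightarrow> 'a \<Rightarrow> bool" where
  "originates_at D g x0 \<longleftrightarrow> 1 \<in> D \<and> g 1 = x0"

definition quasi_geodesic_ray ::
    "real \<Rightarrow> real \<Rightarrow> (nat \<Rightarrow> 'a::metric_space) \<Rightarrow> bool" where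
  "quasi_geodesic_ray q Q g \<longleftrightarrow> integral_quasi_geodesic q Q {1..} g"

definition qg_cone ::
    "'a::metric_space \<Rightarrow> real \<Rightarrow> real \<Rightarrow> (nat \<Rightarrow> 'a) \<Rightarrow> nat \<Rightarrow> 'a set" where
  "qg_cone x0 q Q g m =
     {x. \<exists>D h i. integral_quasi_geodesic q Q D h \<and> originates_at D h x0 \<and>
           (\<forall>j\<in>{1..m}. j \<in> D \<and> h j = g j) \<and>
           i \<in> D \<and> m \<le> i \<and> x = h i}"

definition slowly_oscillating :: "('a::metric_space \<Rightarrow> complex) \<Rightarrow> bool" where
  "slowly_oscillating f \<longleftrightarrow>
     (\<forall>x0 (x :: nat \<Rightarrow> 'a) y M.
        filterlim (\<lambda>n. dist x0 (x n)) at_top sequentially \<longrightarrow>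
        0 < M \<longrightarrow> (\<forall>n. dist (x n) (y n) < M) \<longrightarrow>
        (\<lambda>n. cmod (f (x n) - f (y n))) \<longlonglongrightarrow> 0)"

definition geometrically_slowly_oscillating :: "('a::metric_space \<Rightarrow> complex) \<Rightarrow> bool" where
  "geometrically_slowly_oscillating f \<longleftrightarrow>
     bounded (range f) \<and> continuous_on UNIV f \<and> slowly_oscillating f \<and>
     (\<forall>\<epsilon>>0. \<forall>k\<ge>1. \<forall>x0 g. quasi_geodesic_ray k k g \<and> originates_at {1..} g x0 \<longrightarrow>
        (\<exists>m\<ge>1. diameter (f ` qg_cone x0 k k g m) < \<epsilon>))"

definition C_QG :: "('a::metric_space \<Rightarrow> complex) set" where
  "C_QG = {f. geometrically_slowly_oscillating f}"

text \<open>The maximal ideal space of an algebra \<open>A\<close> of functions (with pointwise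
  operations), in Gelfand's form: the nonzero multiplicative linear functionals on \<open>A\<close> with the
  topology of pointwise convergence. Functionals are extensional (\<open>undefined\<close> off \<open>A\<close>),
  so that equality of functionals is equality on \<open>A\<close>.\<close>

definition characters :: "('a \<Rightarrow> complex) set \<Rightarrow> (('a \<Rightarrow> complex) \<Rightarrow> complex) set" where
  "characters A =
     {\<phi> \<in> extensional A.
        (\<forall>u\<in>A. \<forall>v\<in>A. \<phi> (\<lambda>x. u x + v x) = \<phi> u + \<phi> v) \<and>
        (\<forall>c. \<forall>u\<in>A. \<phi> (\<lambda>x. c * u x) = c * \<phi> u) \<and>
        (\<forall>u\<in>A. \<forall>v\<in>A. \<phi> (\<lambda>x. u x * v x) = \<phi> u * \<phi> v) \<and>
        (\<exists>u\<in>A. \<phi> u \<noteq> 0)}"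

definition maximal_ideal_space ::
    "('a \<Rightarrow> complex) set \<Rightarrow> (('a \<Rightarrow> complex) \<Rightarrow> complex) topology" where
  "maximal_ideal_space A = subtopology (product_topology (\<lambda>_. euclidean) A) (characters A)"

definition QG_compactification :: "(('a::metric_space \<Rightarrow> complex) \<Rightarrow> complex) topology" where
  "QG_compactification = maximal_ideal_space C_QG"

text \<open>The canonical map of \<open>X\<close> into its compactification, sending a point to
  evaluation at that point; its image is the copy of \<open>X\<close> in \<open>X\<^sub>Q\<^sub>G\<close>.\<close>

definition QG_embed :: "'a::metric_space \<Rightarrow> (('a \<Rightarrow> complex) \<Rightarrow> complex)" where
  "QG_embed x = (\<lambda>u\<in>C_QG. u x)"

definition QG_boundary :: "(('a::metric_space \<Rightarrow> complex) \<Rightarrow> complex) set" where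
  "QG_boundary = topspace QG_compactification - range QG_embed"

definition quasi_isometric_embedding ::
    "('a::metric_space \<Rightarrow> 'b::metric_space) \<Rightarrow> bool" where
  "quasi_isometric_embedding f \<longleftrightarrow>
     (\<exists>L C :: real. 1 \<le> L \<and> 0 \<le> C \<and>
        (\<forall>x y. dist x y / L - C \<le> dist (f x) (f y) \<and> dist (f x) (f y) \<le> L * dist x y + C))"

definition proper_metric :: "'a::metric_space itself \<Rightarrow> bool" where
  "proper_metric _ \<longleftrightarrow> (\<forall>(x::'a) r. compact (cball x r))"

end

theory Submission
  imports Defs
begin

text \<open>
  A quasi-isometric embedding \<open>f\<close> carries integral \<open>(k,k)\<close>-quasi-geodesics to integral
  \<open>(k',k')\<close>-quasi-geodesics, hence \<open>m\<close>-cones into \<open>m\<close>-cones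
  (\<open>image_qg_cone_subset\<close>), and it preserves both bounded distance and escape to infinity. So
  composition with \<open>f\<close> is a unital homomorphism from \<open>C_QG\<close> of the target to \<open>C_QG\<close> of the
  source (\<open>C_QG_compose\<close>), and the extension of \<open>f\<close> is its Gelfand dual
  \<open>\<phi> \<mapsto> (v \<mapsto> \<phi> (v \<circ> f))\<close>.

  That boundary goes to boundary rests on a characterisation of the interior characters: for a
  proper space, a character that is nonzero at some continuous function of bounded support is evaluation
  at a point (\<open>character_eq_QG_embed\<close>). If the image of \<open>\<phi>\<close> were evaluation at \<open>y\<close>,
  then \<open>\<phi>\<close> would take the value 1 at \<open>v \<circ> f\<close>, where \<open>v\<close> is a bump function around
  \<open>y\<close>. The lower quasi-isometry bound makes the support of \<open>v \<circ> f\<close> bounded, so \<open>\<phi>\<close>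
  is evaluation at a point and is not in the boundary.
\<close>

section \<open>The algebra of geometrically slowly-oscillating functions\<close>

lemma qg_cone_antimono: "m \<le> n \<Longrightarrow> qg_cone x0 q Q g n \<subseteq> qg_cone x0 q Q g m"
  unfolding qg_cone_def by fastforce

text \<open>Diameters are replaced by pairwise estimates, which is what the closure properties below
  use. Boundedness of \<open>u\<close> matters here because the diameter of an unbounded set is a junk
  value.\<close>

lemma C_QG_iff:
  "u \<in> C_QG \<longleftrightarrow>
     bounded (range u) \<and> continuous_on UNIV u \<and> slowly_oscillating u \<and>
     (\<forall>\<epsilon>>0. \<forall>k\<ge>1. \<forall>x0 g. quasi_geodesic_ray k k g \<and> originates_at {1..} g x0 \<longrightarrow>
        (\<exists>m\<ge>1. \<forall>x\<in>qg_cone x0 k k g m. \<forall>y\<in>qg_cone x0 k k g m. cmod (u x - u y) < \<epsilon>))"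
    (is "_ \<longleftrightarrow> ?B \<and> ?C \<and> ?S \<and> ?P")
proof -
  have diam: "(\<forall>x\<in>K. \<forall>y\<in>K. cmod (u x - u y) < \<epsilon>)"
    if "?B" "diameter (u ` K) < \<epsilon>" for K \<epsilon>
  proof (intro ballI)
    fix x y assume "x \<in> K" "y \<in> K"
    moreover have "bounded (u ` K)"
      using that(1) by (rule bounded_subset) auto
    ultimately have "dist (u x) (u y) \<le> diameter (u ` K)"
      by (intro diameter_bounded_bound) auto
    then show "cmod (u x - u y) < \<epsilon>" using that(2) by (simp add: dist_norm)
  qed
  have diam': "diameter (u ` K) < \<epsilon>"
    if "0 < \<epsilon>" "\<forall>x\<in>K. \<forall>y\<in>K. cmod (u x - u y) < \<epsilon> / 2" for K \<epsilon>
  proof -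
    have "diameter (u ` K) \<le> \<epsilon> / 2"
      using that by (intro diameter_le) (auto simp: dist_norm intro: less_imp_le)
    then show ?thesis using that(1) by simp
  qed
  show ?thesis
  proof
    assume "u \<in> C_QG"
    then have *: "?B" "?C" "?S"
      and G: "\<And>\<epsilon> k x0 g. 0 < \<epsilon> \<Longrightarrow> 1 \<le> k \<Longrightarrow> quasi_geodesic_ray k k g \<Longrightarrow>
        originates_at {1..} g x0 \<Longrightarrow> \<exists>m\<ge>1. diameter (u ` qg_cone x0 k k g m) < \<epsilon>"
      by (auto simp: C_QG_def geometrically_slowly_oscillating_def)
    have "?P" by (meson G diam[OF *(1)])
    with * show "?B \<and> ?C \<and> ?S \<and> ?P" by blast
  next
    assume *: "?B \<and> ?C \<and> ?S \<and> ?P"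
    have "\<exists>m\<ge>1. diameter (u ` qg_cone x0 k k g m) < \<epsilon>"
      if "0 < \<epsilon>" "1 \<le> k" "quasi_geodesic_ray k k g" "originates_at {1..} g x0" for \<epsilon> k x0 g
    proof -
      have "0 < \<epsilon> / 2" using that by simp
      with * that(2-) obtain m where "1 \<le> m"
        "\<forall>x\<in>qg_cone x0 k k g m. \<forall>y\<in>qg_cone x0 k k g m. cmod (u x - u y) < \<epsilon> / 2"
        by meson
      with diam'[OF that(1)] show ?thesis by blast
    qed
    with * show "u \<in> C_QG"
      by (auto simp: C_QG_def geometrically_slowly_oscillating_def)
  qed
qed

lemma C_QG_boundedE:
  assumes "u \<in> C_QG"
  obtains B where "0 \<le> B" "\<And>x. cmod (u x) \<le> B"
proof -
  from assms obtain B where "\<forall>x. cmod (u x) \<le> B"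
    unfolding C_QG_iff bounded_iff by auto
  moreover from this have "0 \<le> B" by (meson norm_ge_zero order_trans)
  ultimately show ?thesis using that by blast
qed

text \<open>Every condition defining \<open>C_QG\<close> says that some differences of values are small, so it
  passes to functions whose differences are controlled by those of two members. All the algebra
  operations are instances.\<close>

lemma C_QG_dominated:
  assumes u: "u \<in> C_QG" and v: "v \<in> C_QG" and B: "0 \<le> B"
    and le: "\<And>x y. cmod (w x - w y) \<le> B * (cmod (u x - u y) + cmod (v x - v y))"
  shows "w \<in> C_QG"
  unfolding C_QG_iff
proof (intro conjI)
  obtain Bu where Bu: "0 \<le> Bu" "\<And>x. cmod (u x) \<le> Bu" using C_QG_boundedE[OF u] by blast
  obtain Bv where Bv: "0 \<le> Bv" "\<And>x. cmod (v x) \<le> Bv" using C_QG_boundedE[OF v] by blast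
  have "cmod (w x) \<le> cmod (w undefined) + B * ((Bu + Bu) + (Bv + Bv))" for x
  proof -
    have "cmod (u x - u undefined) \<le> Bu + Bu" "cmod (v x - v undefined) \<le> Bv + Bv"
      using Bu(2) Bv(2) by (meson norm_triangle_ineq4 order_trans add_mono)+
    then have "B * (cmod (u x - u undefined) + cmod (v x - v undefined))
        \<le> B * ((Bu + Bu) + (Bv + Bv))"
      using B by (intro mult_left_mono) auto
    then show ?thesis
      using le[of x undefined] norm_triangle_sub[of "w x" "w undefined"] by linarith
  qed
  then show "bounded (range w)" unfolding bounded_iff by blast
next
  have "isCont w x" for x
  proof -
    have "(u \<longlongrightarrow> u x) (at x)" "(v \<longlongrightarrow> v x) (at x)"
      using u v by (auto simp: C_QG_iff continuous_on_eq_continuous_at isCont_def)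
    then have "((\<lambda>y. B * (cmod (u y - u x) + cmod (v y - v x))) \<longlongrightarrow> 0) (at x)"
      by (auto intro!: tendsto_eq_intros)
    then have "((\<lambda>y. w y - w x) \<longlongrightarrow> 0) (at x)"
      by (rule Lim_null_comparison[rotated]) (use le in auto)
    then show ?thesis by (simp add: isCont_def LIM_zero_iff)
  qed
  then show "continuous_on UNIV w" by (simp add: continuous_at_imp_continuous_on)
next
  show "slowly_oscillating w"
    unfolding slowly_oscillating_def
  proof (intro allI impI)
    fix x0 and x y :: "nat \<Rightarrow> 'a" and M :: real
    assume *: "filterlim (\<lambda>n. dist x0 (x n)) at_top sequentially" "0 < M"
      "\<forall>n. dist (x n) (y n) < M"
    have "(\<lambda>n. cmod (u (x n) - u (y n))) \<longlonglongrightarrow> 0" "(\<lambda>n. cmod (v (x n) - v (y n))) \<longlonglongrightarrow> 0"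
      using u v * unfolding C_QG_iff slowly_oscillating_def by blast+
    then have "(\<lambda>n. B * (cmod (u (x n) - u (y n)) + cmod (v (x n) - v (y n)))) \<longlonglongrightarrow> 0"
      by (intro tendsto_mult_right_zero tendsto_add_zero)
    then show "(\<lambda>n. cmod (w (x n) - w (y n))) \<longlonglongrightarrow> 0"
      by (rule Lim_null_comparison[rotated]) (use le in auto)
  qed
next
  show "\<forall>\<epsilon>>0. \<forall>k\<ge>1. \<forall>x0 g. quasi_geodesic_ray k k g \<and> originates_at {1..} g x0 \<longrightarrow>
     (\<exists>m\<ge>1. \<forall>x\<in>qg_cone x0 k k g m. \<forall>y\<in>qg_cone x0 k k g m. cmod (w x - w y) < \<epsilon>)"
  proof (intro allI impI)
    fix \<epsilon> k :: real and x0 and g :: "nat \<Rightarrow> 'a"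
    assume e: "0 < \<epsilon>" and g: "1 \<le> k" "quasi_geodesic_ray k k g \<and> originates_at {1..} g x0"
    define \<delta> where "\<delta> = \<epsilon> / (2 * (B + 1))"
    have "0 < \<delta>" using e B by (simp add: \<delta>_def)
    have "B * (\<delta> + \<delta>) < \<epsilon>" using e B by (simp add: \<delta>_def divide_simps)
    obtain m1 where m1: "1 \<le> m1"
      "\<And>x y. \<lbrakk>x \<in> qg_cone x0 k k g m1; y \<in> qg_cone x0 k k g m1\<rbrakk> \<Longrightarrow> cmod (u x - u y) < \<delta>"
      using u g \<open>0 < \<delta>\<close> unfolding C_QG_iff by meson
    obtain m2 where m2: "1 \<le> m2"
      "\<And>x y. \<lbrakk>x \<in> qg_cone x0 k k g m2; y \<in> qg_cone x0 k k g m2\<rbrakk> \<Longrightarrow> cmod (v x - v y) < \<delta>"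
      using v g \<open>0 < \<delta>\<close> unfolding C_QG_iff by meson
    show "\<exists>m\<ge>1. \<forall>x\<in>qg_cone x0 k k g m. \<forall>y\<in>qg_cone x0 k k g m. cmod (w x - w y) < \<epsilon>"
    proof (intro exI[of _ "max m1 m2"] conjI ballI)
      show "1 \<le> max m1 m2" using m1 by simp
      fix x y assume xy: "x \<in> qg_cone x0 k k g (max m1 m2)" "y \<in> qg_cone x0 k k g (max m1 m2)"
      then have "x \<in> qg_cone x0 k k g m1" "y \<in> qg_cone x0 k k g m1"
        "x \<in> qg_cone x0 k k g m2" "y \<in> qg_cone x0 k k g m2"
        using qg_cone_antimono[of m1 "max m1 m2" x0 k k g]
          qg_cone_antimono[of m2 "max m1 m2" x0 k k g] by auto
      then have "cmod (u x - u y) < \<delta>" "cmod (v x - v y) < \<delta>"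
        by (simp_all add: m1(2) m2(2))
      then have "B * (cmod (u x - u y) + cmod (v x - v y)) \<le> B * (\<delta> + \<delta>)"
        using B by (intro mult_left_mono) auto
      then show "cmod (w x - w y) < \<epsilon>"
        using le[of x y] \<open>B * (\<delta> + \<delta>) < \<epsilon>\<close> by linarith
    qed
  qed
qed

lemma C_QG_add:
  assumes "u \<in> C_QG" "v \<in> C_QG"
  shows "(\<lambda>x. u x + v x) \<in> C_QG"
proof (rule C_QG_dominated[OF assms, of 1])
  fix x y
  show "cmod (u x + v x - (u y + v y)) \<le> 1 * (cmod (u x - u y) + cmod (v x - v y))"
    using norm_triangle_ineq[of "u x - u y" "v x - v y"] by (simp add: algebra_simps)
qed simp

lemma C_QG_scale:
  assumes "u \<in> C_QG"
  shows "(\<lambda>x. c * u x) \<in> C_QG"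
proof (rule C_QG_dominated[OF assms assms, of "cmod c"])
  fix x y
  have "cmod (c * u x - c * u y) = cmod c * cmod (u x - u y)"
    by (metis norm_mult right_diff_distrib)
  also have "\<dots> \<le> cmod c * (cmod (u x - u y) + cmod (u x - u y))"
    by (intro mult_left_mono) auto
  finally show "cmod (c * u x - c * u y) \<le> cmod c * (cmod (u x - u y) + cmod (u x - u y))" .
qed simp

lemma C_QG_cnj:
  assumes "u \<in> C_QG"
  shows "(\<lambda>x. cnj (u x)) \<in> C_QG"
proof (rule C_QG_dominated[OF assms assms, of 1])
  fix x y
  have "cmod (cnj (u x) - cnj (u y)) = cmod (u x - u y)"
    by (metis complex_cnj_diff complex_mod_cnj)
  then show "cmod (cnj (u x) - cnj (u y)) \<le> 1 * (cmod (u x - u y) + cmod (u x - u y))"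
    by simp
qed simp

lemma C_QG_mult:
  assumes "u \<in> C_QG" "v \<in> C_QG"
  shows "(\<lambda>x. u x * v x) \<in> C_QG"
proof -
  obtain Bu where Bu: "0 \<le> Bu" "\<And>x. cmod (u x) \<le> Bu" using C_QG_boundedE[OF assms(1)] by blast
  obtain Bv where Bv: "0 \<le> Bv" "\<And>x. cmod (v x) \<le> Bv" using C_QG_boundedE[OF assms(2)] by blast
  show ?thesis
  proof (rule C_QG_dominated[OF assms, of "Bu + Bv"])
    fix x y
    have "u x * v x - u y * v y = (u x - u y) * v x + u y * (v x - v y)"
      by (simp add: algebra_simps)
    then have "cmod (u x * v x - u y * v y)
        \<le> cmod (u x - u y) * cmod (v x) + cmod (u y) * cmod (v x - v y)"
      by (metis norm_mult norm_triangle_ineq)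
    also have "\<dots> \<le> cmod (u x - u y) * (Bu + Bv) + (Bu + Bv) * cmod (v x - v y)"
      using Bu Bv by (intro add_mono mult_left_mono mult_right_mono) (auto simp: add_increasing add_increasing2)
    finally show "cmod (u x * v x - u y * v y)
        \<le> (Bu + Bv) * (cmod (u x - u y) + cmod (v x - v y))"
      by (simp add: algebra_simps)
  qed (use Bu Bv in auto)
qed

text \<open>A point \<open>h i\<close> of the \<open>m\<close>-cone is at distance at least \<open>(i - 1)/k - k\<close> from the
  base point, so cones leave every ball; on a function of bounded support each oscillation
  condition is eventually about the constant 0.\<close>

lemma C_QG_bounded_support:
  assumes bdd: "bounded (range w)" and cont: "continuous_on UNIV w"
    and supp: "\<And>x. r < dist a x \<Longrightarrow> w x = 0"
  shows "w \<in> C_QG"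
  unfolding C_QG_iff
proof (intro conjI bdd cont)
  show "slowly_oscillating w"
    unfolding slowly_oscillating_def
  proof (intro allI impI)
    fix x0 and x y :: "nat \<Rightarrow> 'a" and M :: real
    assume *: "filterlim (\<lambda>n. dist x0 (x n)) at_top sequentially" "0 < M"
      "\<forall>n. dist (x n) (y n) < M"
    have "\<forall>\<^sub>F n in sequentially. r + M + dist a x0 < dist x0 (x n)"
      using *(1) by (simp add: filterlim_at_top_dense)
    then have "\<forall>\<^sub>F n in sequentially. cmod (w (x n) - w (y n)) = 0"
    proof eventually_elim
      case (elim n)
      have "dist x0 (x n) \<le> dist a x0 + dist a (x n)" by (rule dist_triangle3)
      moreover have "dist a (x n) \<le> dist a (y n) + dist (x n) (y n)" by (rule dist_triangle2)
      moreover have "dist (x n) (y n) < M" using *(3) by blast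
      ultimately have "r < dist a (x n)" "r < dist a (y n)" using elim *(2) by linarith+
      then show ?case by (simp add: supp)
    qed
    then show "(\<lambda>n. cmod (w (x n) - w (y n))) \<longlonglongrightarrow> 0" by (rule tendsto_eventually)
  qed
next
  show "\<forall>\<epsilon>>0. \<forall>k\<ge>1. \<forall>x0 g. quasi_geodesic_ray k k g \<and> originates_at {1..} g x0 \<longrightarrow>
     (\<exists>m\<ge>1. \<forall>x\<in>qg_cone x0 k k g m. \<forall>y\<in>qg_cone x0 k k g m. cmod (w x - w y) < \<epsilon>)"
  proof (intro allI impI)
    fix \<epsilon> k :: real and x0 and g :: "nat \<Rightarrow> 'a"
    assume e: "0 < \<epsilon>" and k: "1 \<le> k"
    obtain m0 where m0: "k * (r + dist a x0 + k + 1) < real m0" using reals_Archimedean2 by blast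
    define m where "m = Suc m0"
    have w0: "w x = 0" if x: "x \<in> qg_cone x0 k k g m" for x
    proof -
      obtain D h i where h: "integral_quasi_geodesic k k D h" "1 \<in> D" "h 1 = x0" "i \<in> D"
        "m \<le> i" "x = h i"
        using x unfolding qg_cone_def originates_at_def by blast
      have "\<bar>real 1 - real i\<bar> / k - k \<le> dist x0 x"
        using h unfolding integral_quasi_geodesic_def by metis
      moreover have "real m0 \<le> \<bar>real 1 - real i\<bar>" using h(5) by (simp add: m_def)
      moreover have "r + dist a x0 + k + 1 < real m0 / k"
        using m0 k by (simp add: field_simps)
      ultimately have "r + dist a x0 + k + 1 - k < dist x0 x"
        using k divide_right_mono[of "real m0" "\<bar>real 1 - real i\<bar>" k] by linarith
      moreover have "dist x0 x \<le> dist a x0 + dist a x" by (rule dist_triangle3)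
      ultimately show ?thesis by (intro supp) linarith
    qed
    show "\<exists>m\<ge>1. \<forall>x\<in>qg_cone x0 k k g m. \<forall>y\<in>qg_cone x0 k k g m. cmod (w x - w y) < \<epsilon>"
      using w0 e by (intro exI[of _ m]) (simp add: m_def)
  qed
qed

lemma C_QG_const: "(\<lambda>x. c) \<in> C_QG"
proof -
  have zero: "(\<lambda>x. 0) \<in> C_QG" by (rule C_QG_bounded_support) auto
  show ?thesis by (rule C_QG_dominated[OF zero zero, of 0]) auto
qed

section \<open>Characters of the algebra\<close>

lemma charactersD:
  assumes "\<phi> \<in> characters A"
  shows "\<phi> \<in> extensional A"
    and "\<And>u v. u \<in> A \<Longrightarrow> v \<in> A \<Longrightarrow> \<phi> (\<lambda>x. u x + v x) = \<phi> u + \<phi> v"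
    and "\<And>c u. u \<in> A \<Longrightarrow> \<phi> (\<lambda>x. c * u x) = c * \<phi> u"
    and "\<And>u v. u \<in> A \<Longrightarrow> v \<in> A \<Longrightarrow> \<phi> (\<lambda>x. u x * v x) = \<phi> u * \<phi> v"
    and "\<exists>u\<in>A. \<phi> u \<noteq> 0"
proof -
  note conds = assms[unfolded characters_def mem_Collect_eq]
  show "\<phi> \<in> extensional A" by (rule conds[THEN conjunct1])
  show "\<phi> (\<lambda>x. u x + v x) = \<phi> u + \<phi> v" if "u \<in> A" "v \<in> A" for u v
    using conds[THEN conjunct2, THEN conjunct1, rule_format, OF that] .
  show "\<phi> (\<lambda>x. c * u x) = c * \<phi> u" if "u \<in> A" for c u
    using conds[THEN conjunct2, THEN conjunct2, THEN conjunct1, rule_format, OF that] .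
  show "\<phi> (\<lambda>x. u x * v x) = \<phi> u * \<phi> v" if "u \<in> A" "v \<in> A" for u v
    using conds[THEN conjunct2, THEN conjunct2, THEN conjunct2, THEN conjunct1, rule_format, OF that] .
  show "\<exists>u\<in>A. \<phi> u \<noteq> 0"
    by (rule conds[THEN conjunct2, THEN conjunct2, THEN conjunct2, THEN conjunct2])
qed

lemma character_const:
  assumes \<phi>: "\<phi> \<in> characters C_QG"
  shows "\<phi> (\<lambda>x. c) = c"
proof -
  obtain u where u: "u \<in> C_QG" "\<phi> u \<noteq> 0" using charactersD(5)[OF \<phi>] by blast
  have "\<phi> (\<lambda>x. 1 * u x) = \<phi> (\<lambda>x. 1) * \<phi> u"
    using charactersD(4)[OF \<phi> C_QG_const u(1)] .
  then have "\<phi> (\<lambda>x. 1) = 1" using u(2) by simp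
  then show ?thesis using charactersD(3)[OF \<phi> C_QG_const, of c 1] by simp
qed

lemma topspace_QG_compactification:
  "topspace QG_compactification = (characters C_QG :: (('a::metric_space \<Rightarrow> complex) \<Rightarrow> complex) set)"
proof -
  have "characters C_QG \<subseteq> (extensional C_QG :: (('a \<Rightarrow> complex) \<Rightarrow> complex) set)"
    using charactersD(1) by blast
  then show ?thesis
    by (auto simp: QG_compactification_def maximal_ideal_space_def PiE_def)
qed

lemma character_sum_cnj_eq_0:
  assumes \<phi>: "\<phi> \<in> characters C_QG" and "finite I"
    and "\<And>i. i \<in> I \<Longrightarrow> b i \<in> C_QG" "\<And>i. i \<in> I \<Longrightarrow> \<phi> (b i) = 0"
  shows "(\<lambda>x. \<Sum>i\<in>I. b i x * cnj (b i x)) \<in> C_QG \<and> \<phi> (\<lambda>x. \<Sum>i\<in>I. b i x * cnj (b i x)) = 0"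
  using assms(2-)
proof (induction I rule: finite_induct)
  case empty
  show ?case using C_QG_const[of 0] character_const[OF \<phi>, of 0] by simp
next
  case (insert i I)
  have b: "b i \<in> C_QG" "\<phi> (b i) = 0" using insert.prems by auto
  have c: "(\<lambda>x. b i x * cnj (b i x)) \<in> C_QG" by (intro C_QG_mult C_QG_cnj b)
  have "\<phi> (\<lambda>x. b i x * cnj (b i x)) = 0"
    using charactersD(4)[OF \<phi> b(1) C_QG_cnj[OF b(1)]] b(2) by simp
  moreover have IH: "(\<lambda>x. \<Sum>i\<in>I. b i x * cnj (b i x)) \<in> C_QG"
    "\<phi> (\<lambda>x. \<Sum>i\<in>I. b i x * cnj (b i x)) = 0"
    using insert by auto
  ultimately show ?case
    using C_QG_add[OF c IH(1)] charactersD(2)[OF \<phi> c IH(1)] insert.hyps by simp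
qed

text \<open>If \<open>\<phi>\<close> is not evaluation at \<open>x\<close>, some member of the kernel of \<open>\<phi>\<close> is nonzero
  near \<open>x\<close>. Were this so at every point, compactness would give a kernel element
  \<open>s = \<Sum> |b\<^sub>i|\<^sup>2\<close> without zeros on the support of \<open>w\<close>. Then \<open>w = s (w / s)\<close> would lie in the
  kernel too, as \<open>w / s\<close> is again continuous of bounded support.\<close>

lemma character_eq_QG_embed:
  fixes \<phi> :: "('a::metric_space \<Rightarrow> complex) \<Rightarrow> complex"
  assumes proper: "proper_metric TYPE('a)" and \<phi>: "\<phi> \<in> characters C_QG"
    and w: "continuous_on UNIV w" and supp: "\<And>x. r < dist a x \<Longrightarrow> w x = 0"
    and nz: "\<phi> w \<noteq> 0"
  shows "\<phi> \<in> range QG_embed"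
proof (rule ccontr)
  assume notin: "\<phi> \<notin> range QG_embed"
  have "\<exists>b. b \<in> C_QG \<and> \<phi> b = 0 \<and> b x \<noteq> 0" for x
  proof -
    have "\<phi> \<noteq> QG_embed x" using notin by blast
    moreover have "\<phi> = QG_embed x" if "\<And>u. u \<in> C_QG \<Longrightarrow> \<phi> u = u x"
      using charactersD(1)[OF \<phi>] that
      by (intro extensionalityI[of _ C_QG]) (auto simp: QG_embed_def)
    ultimately obtain u where u: "u \<in> C_QG" "\<phi> u \<noteq> u x" by blast
    have "\<phi> (\<lambda>y. u y + - \<phi> u) = 0"
      using charactersD(2)[OF \<phi> u(1) C_QG_const, of "- \<phi> u"] character_const[OF \<phi>, of "- \<phi> u"]
      by simp
    then show ?thesis
      using u(2) C_QG_add[OF u(1) C_QG_const, of "- \<phi> u"]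
      by (intro exI[of _ "\<lambda>y. u y + - \<phi> u"]) auto
  qed
  then obtain b where b: "\<And>x. b x \<in> C_QG" "\<And>x. \<phi> (b x) = 0" "\<And>x. b x x \<noteq> 0"
    by metis
  \<comment> \<open>The ball is larger than the support, so that \<open>w / s\<close> vanishes near its boundary and
    the zeros of \<open>s\<close> outside do not spoil continuity.\<close>
  define K where "K = cball a (r + 1)"
  have "compact K" using proper unfolding proper_metric_def K_def by blast
  moreover have "open {y. b x y \<noteq> 0}" for x
  proof -
    have "continuous_on UNIV (b x)" using b(1)[of x] by (simp add: C_QG_iff)
    then show ?thesis by (intro open_Collect_neq) (auto intro: continuous_intros)
  qed
  moreover have "K \<subseteq> (\<Union>x\<in>UNIV. {y. b x y \<noteq> 0})" using b(3) by auto
  ultimately obtain I where I: "finite I" "K \<subseteq> (\<Union>x\<in>I. {y. b x y \<noteq> 0})"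
    by (rule compactE_image)
  define s where "s = (\<lambda>x. \<Sum>i\<in>I. b i x * cnj (b i x))"
  have s: "s \<in> C_QG" "\<phi> s = 0"
    using character_sum_cnj_eq_0[OF \<phi> I(1), of b] b unfolding s_def by auto
  have s_eq: "s x = of_real (\<Sum>i\<in>I. (cmod (b i x))\<^sup>2)" for x
    unfolding s_def by (simp only: complex_norm_square of_real_sum)
  have s_nz: "s x \<noteq> 0" if "x \<in> K" for x
  proof -
    obtain i where "i \<in> I" "b i x \<noteq> 0" using I(2) \<open>x \<in> K\<close> by auto
    then have "0 < (\<Sum>i\<in>I. (cmod (b i x))\<^sup>2)"
      by (intro sum_pos2[OF I(1)]) auto
    then show ?thesis unfolding s_eq of_real_eq_0_iff by simp
  qed
  have cs: "continuous_on UNIV s" using s(1) by (simp add: C_QG_iff)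
  have "continuous_on (ball a (r + 1)) (\<lambda>x. w x / s x)"
    using s_nz
    by (intro continuous_intros continuous_on_subset[OF w] continuous_on_subset[OF cs])
       (auto simp: K_def)
  moreover have "continuous_on (- cball a r) (\<lambda>x. w x / s x)"
    using supp by (subst continuous_on_cong[OF refl, where g="\<lambda>x. 0"]) auto
  moreover have "ball a (r + 1) \<union> - cball a r = UNIV" by auto
  ultimately have cont: "continuous_on UNIV (\<lambda>x. w x / s x)"
    by (metis continuous_on_open_Un open_ball closed_cball open_Compl)
  have "range (\<lambda>x. w x / s x) \<subseteq> insert 0 ((\<lambda>x. w x / s x) ` K)"
  proof
    fix z assume "z \<in> range (\<lambda>x. w x / s x)"
    then obtain x where "z = w x / s x" by blast
    then show "z \<in> insert 0 ((\<lambda>x. w x / s x) ` K)"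
      using supp[of x] by (cases "x \<in> K") (auto simp: K_def)
  qed
  moreover have "bounded ((\<lambda>x. w x / s x) ` K)"
    using \<open>compact K\<close> cont
    by (meson compact_continuous_image compact_imp_bounded continuous_on_subset subset_UNIV)
  ultimately have "bounded (range (\<lambda>x. w x / s x))"
    by (meson bounded_insert bounded_subset)
  then have q: "(\<lambda>x. w x / s x) \<in> C_QG"
    by (rule C_QG_bounded_support[OF _ cont, of r a]) (simp add: supp)
  have "w = (\<lambda>x. s x * (w x / s x))"
  proof
    fix x
    show "w x = s x * (w x / s x)"
      using s_nz[of x] supp[of x] by (cases "x \<in> K") (auto simp: K_def)
  qed
  then have "\<phi> w = \<phi> s * \<phi> (\<lambda>x. w x / s x)"
    using charactersD(4)[OF \<phi> s(1) q] by simp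
  then show False using nz s(2) by simp
qed

section \<open>Composition with a quasi-isometric embedding\<close>

text \<open>The constant \<open>L * k + C\<close> serves both as the multiplicative and as the additive constant
  of the image of a \<open>(k,k)\<close>-quasi-geodesic.\<close>

lemma integral_quasi_geodesic_compose:
  assumes LC: "1 \<le> L" "0 \<le> C" and k: "1 \<le> k"
    and f: "\<And>x y. dist x y / L - C \<le> dist (f x) (f y)" "\<And>x y. dist (f x) (f y) \<le> L * dist x y + C"
    and h: "integral_quasi_geodesic k k D h"
  shows "integral_quasi_geodesic (L * k + C) (L * k + C) D (\<lambda>i. f (h i))"
  unfolding integral_quasi_geodesic_def
proof (intro conjI ballI)
  show "integral_interval D" using h by (simp add: integral_quasi_geodesic_def)
  fix x y assume xy: "x \<in> D" "y \<in> D"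
  define t where "t = \<bar>real x - real y\<bar>"
  have t: "0 \<le> t" by (simp add: t_def)
  have 1: "t / k - k \<le> dist (h x) (h y)" and 2: "dist (h x) (h y) \<le> k * t + k"
    using h xy unfolding integral_quasi_geodesic_def t_def by blast+
  have "(t / k - k) / L \<le> dist (h x) (h y) / L"
    using 1 LC by (intro divide_right_mono) auto
  then have "t / (L * k) - k / L - C \<le> dist (f (h x)) (f (h y))"
    using f(1)[of "h x" "h y"] LC k by (simp add: diff_divide_distrib mult.commute)
  moreover have "t / (L * k + C) \<le> t / (L * k)"
    using t LC k by (intro divide_left_mono) (auto intro!: mult_pos_pos add_pos_nonneg)
  moreover have "k / L \<le> L * k"
  proof -
    have "k / L \<le> k / 1" using LC k by (intro divide_left_mono) auto
    also have "k / 1 \<le> L * k" using LC k by simp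
    finally show ?thesis .
  qed
  ultimately show "\<bar>real x - real y\<bar> / (L * k + C) - (L * k + C) \<le> dist (f (h x)) (f (h y))"
    unfolding t_def[symmetric] by linarith
  have "L * dist (h x) (h y) \<le> L * (k * t + k)"
    using 2 LC by (intro mult_left_mono) auto
  then have "dist (f (h x)) (f (h y)) \<le> L * k * t + (L * k + C)"
    using f(2)[of "h x" "h y"] by (simp add: algebra_simps)
  also have "\<dots> \<le> (L * k + C) * t + (L * k + C)"
    using LC t by (simp add: distrib_right)
  finally show "dist (f (h x)) (f (h y)) \<le> (L * k + C) * \<bar>real x - real y\<bar> + (L * k + C)"
    unfolding t_def .
qed

lemma image_qg_cone_subset:
  assumes "1 \<le> L" "0 \<le> C" "1 \<le> k"
    and "\<And>x y. dist x y / L - C \<le> dist (f x) (f y)" "\<And>x y. dist (f x) (f y) \<le> L * dist x y + C"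
  shows "f ` qg_cone x0 k k g m \<subseteq> qg_cone (f x0) (L * k + C) (L * k + C) (\<lambda>i. f (g i)) m"
proof
  fix z assume "z \<in> f ` qg_cone x0 k k g m"
  then obtain D h i where h: "integral_quasi_geodesic k k D h" "originates_at D h x0"
    "\<forall>j\<in>{1..m}. j \<in> D \<and> h j = g j" "i \<in> D" "m \<le> i" "z = f (h i)"
    unfolding qg_cone_def by blast
  have "integral_quasi_geodesic (L * k + C) (L * k + C) D (\<lambda>i. f (h i))"
    by (rule integral_quasi_geodesic_compose[OF assms h(1)])
  then show "z \<in> qg_cone (f x0) (L * k + C) (L * k + C) (\<lambda>i. f (g i)) m"
    using h(2-) unfolding qg_cone_def originates_at_def
    by (auto intro!: exI[of _ D] exI[of _ "\<lambda>i. f (h i)"] exI[of _ i])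
qed

lemma C_QG_compose:
  assumes cont: "continuous_on UNIV f" and qi: "quasi_isometric_embedding f" and v: "v \<in> C_QG"
  shows "(\<lambda>x. v (f x)) \<in> C_QG"
proof -
  obtain L C where LC: "1 \<le> L" "0 \<le> C"
    and f: "\<And>x y. dist x y / L - C \<le> dist (f x) (f y)"
      "\<And>x y. dist (f x) (f y) \<le> L * dist x y + C"
    using qi unfolding quasi_isometric_embedding_def by blast
  show ?thesis
    unfolding C_QG_iff
  proof (intro conjI)
    show "bounded (range (\<lambda>x. v (f x)))"
      using v by (auto simp: C_QG_iff bounded_iff)
    show "continuous_on UNIV (\<lambda>x. v (f x))"
      using v cont by (auto simp: C_QG_iff intro: continuous_on_compose2)
    show "slowly_oscillating (\<lambda>x. v (f x))"
      unfolding slowly_oscillating_def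
    proof (intro allI impI)
      fix x0 and x y :: "nat \<Rightarrow> 'a" and M :: real
      assume *: "filterlim (\<lambda>n. dist x0 (x n)) at_top sequentially" "0 < M"
        "\<forall>n. dist (x n) (y n) < M"
      have "filterlim (\<lambda>n. dist (f x0) (f (x n))) at_top sequentially"
        unfolding filterlim_at_top_dense
      proof
        fix Z
        have "\<forall>\<^sub>F n in sequentially. L * (Z + C) < dist x0 (x n)"
          using *(1) by (simp add: filterlim_at_top_dense)
        then show "\<forall>\<^sub>F n in sequentially. Z < dist (f x0) (f (x n))"
        proof eventually_elim
          case (elim n)
          then have "Z + C < dist x0 (x n) / L" using LC by (simp add: field_simps)
          then show ?case using f(1)[of x0 "x n"] by linarith
        qed
      qed
      moreover have "dist (f (x n)) (f (y n)) < L * M + C + 1" for n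
      proof -
        have "L * dist (x n) (y n) \<le> L * M"
          using *(3) LC by (intro mult_left_mono) (auto intro: less_imp_le)
        then show ?thesis using f(2)[of "x n" "y n"] by linarith
      qed
      moreover have "0 < L * M + C + 1" using LC *(2) by (simp add: add_nonneg_pos)
      ultimately show "(\<lambda>n. cmod (v (f (x n)) - v (f (y n)))) \<longlonglongrightarrow> 0"
        using v unfolding C_QG_iff slowly_oscillating_def
        by (elim conjE allE[of _ "f x0"] allE[of _ "\<lambda>n. f (x n)"] allE[of _ "\<lambda>n. f (y n)"]
            allE[of _ "L * M + C + 1"]) blast
    qed
    show "\<forall>\<epsilon>>0. \<forall>k\<ge>1. \<forall>x0 g. quasi_geodesic_ray k k g \<and> originates_at {1..} g x0 \<longrightarrow>
      (\<exists>m\<ge>1. \<forall>x\<in>qg_cone x0 k k g m. \<forall>y\<in>qg_cone x0 k k g m. cmod (v (f x) - v (f y)) < \<epsilon>)"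
    proof (intro allI impI)
      fix \<epsilon> k :: real and x0 and g :: "nat \<Rightarrow> 'a"
      assume e: "0 < \<epsilon>" and k: "1 \<le> k"
        and g: "quasi_geodesic_ray k k g \<and> originates_at {1..} g x0"
      let ?k = "L * k + C"
      have "1 * 1 \<le> L * k" using LC k by (intro mult_mono) auto
      then have "1 \<le> ?k" using LC by simp
      moreover have "quasi_geodesic_ray ?k ?k (\<lambda>i. f (g i))"
        using g integral_quasi_geodesic_compose[OF LC k f] by (simp add: quasi_geodesic_ray_def)
      moreover have "originates_at {1..} (\<lambda>i. f (g i)) (f x0)"
        using g by (simp add: originates_at_def)
      ultimately obtain m where m: "1 \<le> m"
        "\<forall>x\<in>qg_cone (f x0) ?k ?k (\<lambda>i. f (g i)) m. \<forall>y\<in>qg_cone (f x0) ?k ?k (\<lambda>i. f (g i)) m.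
           cmod (v x - v y) < \<epsilon>"
        using v e unfolding C_QG_iff by meson
      then show "\<exists>m\<ge>1. \<forall>x\<in>qg_cone x0 k k g m. \<forall>y\<in>qg_cone x0 k k g m. cmod (v (f x) - v (f y)) < \<epsilon>"
        using image_qg_cone_subset[OF LC k f, of x0 g m] by blast
    qed
  qed
qed

section \<open>The extension to the compactifications\<close>

definition QG_extension ::
    "('a::metric_space \<Rightarrow> 'b::metric_space) \<Rightarrow> (('a \<Rightarrow> complex) \<Rightarrow> complex) \<Rightarrow> ('b \<Rightarrow> complex) \<Rightarrow> complex"
  where "QG_extension f \<phi> = (\<lambda>v\<in>C_QG. \<phi> (\<lambda>x. v (f x)))"

lemma QG_extension_apply: "v \<in> C_QG \<Longrightarrow> QG_extension f \<phi> v = \<phi> (\<lambda>x. v (f x))"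
  by (simp add: QG_extension_def)

lemma QG_extension_QG_embed:
  assumes "continuous_on UNIV f" "quasi_isometric_embedding f"
  shows "QG_extension f (QG_embed x) = QG_embed (f x)"
  using C_QG_compose[OF assms] by (auto simp: QG_extension_def QG_embed_def intro!: restrict_ext)

lemma QG_extension_character:
  assumes f: "continuous_on UNIV f" "quasi_isometric_embedding f" and \<phi>: "\<phi> \<in> characters C_QG"
  shows "QG_extension f \<phi> \<in> characters C_QG"
proof -
  note comp = C_QG_compose[OF f]
  have "QG_extension f \<phi> (\<lambda>x. 1) \<noteq> 0"
    using character_const[OF \<phi>, of 1] by (simp add: QG_extension_apply C_QG_const)
  then have "\<exists>u\<in>C_QG. QG_extension f \<phi> u \<noteq> 0" using C_QG_const by blast
  moreover have "QG_extension f \<phi> \<in> extensional C_QG"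
    by (simp add: QG_extension_def)
  ultimately show ?thesis
    unfolding characters_def
    by (simp add: QG_extension_apply C_QG_add C_QG_scale C_QG_mult comp charactersD(2-4)[OF \<phi>])
qed

lemma continuous_map_QG_extension:
  assumes f: "continuous_on UNIV f" "quasi_isometric_embedding f"
  shows "continuous_map QG_compactification QG_compactification (QG_extension f)"
proof -
  have "continuous_map QG_compactification euclidean (\<lambda>\<phi>. QG_extension f \<phi> v)"
    if v: "v \<in> C_QG" for v
    unfolding QG_extension_apply[OF v] QG_compactification_def maximal_ideal_space_def
    by (intro continuous_map_from_subtopology continuous_map_product_projection
        C_QG_compose[OF f v])
  moreover have "QG_extension f ` topspace QG_compactification \<subseteq> characters C_QG"
    using QG_extension_character[OF f] by (auto simp: topspace_QG_compactification)
  moreover have "QG_extension f ` topspace QG_compactification \<subseteq> extensional C_QG"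
    by (auto simp: QG_extension_def)
  ultimately show ?thesis
    unfolding QG_compactification_def[where 'a='b] maximal_ideal_space_def
    by (auto simp: continuous_map_in_subtopology continuous_map_componentwise)
qed

lemma QG_extension_boundary:
  fixes f :: "'a::metric_space \<Rightarrow> 'b::metric_space"
  assumes proper: "proper_metric TYPE('a)"
    and f: "continuous_on UNIV f" "quasi_isometric_embedding f"
    and \<phi>: "\<phi> \<in> QG_boundary"
  shows "QG_extension f \<phi> \<in> QG_boundary"
proof -
  have char: "\<phi> \<in> characters C_QG" and notin: "\<phi> \<notin> range QG_embed"
    using \<phi> by (auto simp: QG_boundary_def topspace_QG_compactification)
  have False if eq: "QG_extension f \<phi> = QG_embed y" for y
  proof -
    obtain L C where LC: "1 \<le> L" "0 \<le> C"
      and fL: "\<And>x z. dist x z / L - C \<le> dist (f x) (f z)"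
      using f(2) unfolding quasi_isometric_embedding_def by blast
    define v where "v = (\<lambda>z. complex_of_real (max 0 (1 - dist y z)))"
    have cv: "continuous_on UNIV v" unfolding v_def by (intro continuous_intros)
    have v0: "v z = 0" if "1 < dist y z" for z
      using that by (simp add: v_def)
    have "cmod (v z) \<le> 1" for z
      by (simp add: v_def)
    then have "bounded (range v)" by (auto simp: bounded_iff)
    then have v: "v \<in> C_QG" using cv v0 by (rule C_QG_bounded_support)
    define a :: 'a where "a = undefined"
    have "v (f x) = 0" if "L * (1 + C + dist y (f a)) < dist a x" for x
    proof (rule v0)
      have "1 + C + dist y (f a) < dist a x / L" using that LC by (simp add: field_simps)
      then show "1 < dist y (f x)"
        using fL[of a x] dist_triangle3[of "f a" "f x" y] by linarith
    qed
    moreover have "continuous_on UNIV (\<lambda>x. v (f x))"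
      using continuous_on_compose2[OF cv f(1)] by simp
    moreover have "\<phi> (\<lambda>x. v (f x)) \<noteq> 0"
      using fun_cong[OF eq, of v] v by (simp add: QG_extension_apply QG_embed_def v_def)
    ultimately show False
      using character_eq_QG_embed[OF proper char, of "\<lambda>x. v (f x)"] notin by blast
  qed
  then show ?thesis
    using QG_extension_character[OF f char]
    by (auto simp: QG_boundary_def topspace_QG_compactification)
qed

theorem corollary4p13:
  fixes f :: "'a::metric_space \<Rightarrow> 'b::metric_space"
  assumes "proper_metric TYPE('a)"
    and "proper_metric TYPE('b)"
    and "continuous_on UNIV f"
    and "quasi_isometric_embedding f"
  shows "\<exists>F :: (('a \<Rightarrow> complex) \<Rightarrow> complex) \<Rightarrow> (('b \<Rightarrow> complex) \<Rightarrow> complex).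
           continuous_map QG_compactification QG_compactification F \<and>
           (\<forall>x. F (QG_embed x) = QG_embed (f x)) \<and>
           F ` QG_boundary \<subseteq> QG_boundary"
  using continuous_map_QG_extension[OF assms(3,4)] QG_extension_QG_embed[OF assms(3,4)]
    QG_extension_boundary[OF assms(1,3,4)]
  by blast

end
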